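(* For each $\mathcal F\in\{NF,CR,SO\}$, the action protocol $P^\emptyset$ implements the knowledge-based program $\mathbf P$ (taken with $\mathit{next}(h)=|h|\bmod|\mathcal L_{in}|$ and $\sigma(h)=\emptyset$ for all adversary histories $h$) with respect to the no-communication context $\gamma_\emptyset(\mathcal F)$.
   Context: **Setting.** $\mathrm{Ag}\subseteq\mathbb N$ is a (possibly infinite) set of agents. Lanes $\mathcal L=\{0,\dots,\ell-1\}$ are partitioned into incoming lanes $\mathcal L_{in}=\{0,\dots,k-1\}$ ($1<k<\ell$) and outgoing lanes $\mathcal L_{out}$. A move is an element of $\mathcal L_{in}\times\mathcal L_{out}$. A symmetric relation $\mathcal O\subseteq(\mathcal L_{in}\times\mathcal L_{out})^2$ is fixed; two moves are compatible if the pair is in $\mathcal O$; a move is compatible with a set of moves if it is compatible with all its elements. **Adversaries.** A transmission environment is $T\subseteq(\mathcal L_{in}\times\mathbb N)^2$ with $((l,0),(l',0))\in T$ for all $l,l'\in\mathcal L_{in}$. An adversary is $\alpha=(\tau,T,F_t,F_r)$ with $\tau:\mathrm{Ag}\to\mathbb N\times\mathcal L_{in}\times\mathcal L_{out}$ (arrival time, arrival lane, intended departure lane), where distinct agents with the same arrival time have different arrival lanes; $T$ a transmission environment; $F_t,F_r:\mathbb N\times\mathrm{Ag}\to\{0,1\}$ (value $0$ at $(m,i)$: $i$'s transmitter, resp. receiver, fails in round $m+1$). Adversary models: $NF$ is the set of all adversaries with $F_t\equiv F_r\equiv1$; $CR$ the set of all adversaries with $F_r\equiv1$ and such that $F_t(m,i)=0$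 implies $F_t(m',i)=0$ for all $m'>m$; $SO$ the set of all adversaries with $F_r\equiv1$. **Context $\gamma_\emptyset(\mathcal F)$.** An environment state is $s_e=(\alpha,t,(q_l)_{l\in\mathcal L_{in}},\mathit{done})$ with $\alpha\in\mathcal F$, time $t\in\mathbb N$, a queue $q_l$ of agents per incoming lane, and a set $\mathit{done}\subseteq\mathrm{Ag}$. No messages are sent and memory is trivial: agent $i$'s local state is just its sensor reading $\langle\mathit{front}_i,\mathit{lane}_i,\mathit{intent}_i,\mathit{time}_i\rangle$, where $\mathit{front}_i=1$ iff $i$ is at the front of a queue, $\mathit{lane}_i=l$ if $i$ is in $q_l$, $\top$ if $i\in\mathit{done}$, $\bot$ otherwise, $\mathit{intent}_i$ is the departure lane in $\tau(i)$, and $\mathit{time}_i=t$. Actions are $\mathtt{go},\mathtt{noop}$; an action protocol $P$ consists of maps $P_i$ from local states of $i$ to actions. **Runs.** Initially $t=0$ and all queues and $\mathit{done}$ are empty. In round $m+1$ (from time $m$ to $m+1$): each agent $i$ performs $P_i$ of its local state; each agent at the front of a queue performing $\mathtt{go}$ is dequeued and added to $\mathit{done}$; then each agent $i$ with $\tau(i)=(m+1,l,l')$ is appended to $q_l$; time becomes $m+1$, $\alpha$ is unchanged, and the local states are the new sensor readings. $\mathcal I_{\gamma,P}$ is the system of all runs $r$ of $P$ in context $\gamma$; $r_i(m)$ is $i$'s local state at point $(r,m)$. $K_i\phi$ holds at $(r,m)$ iff $\phi$ holds at all points $(r',m')$ of the system with $r'_i(m')=r_i(m)$. $\mathit{going}_i$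 holds at $(r,m)$ iff $\mathit{front}_i=1$ at $(r,m)$ and $\mathit{front}_i=0$ at $(r,m+1)$. **Program $\mathbf P$.** An adversary history of a run at time $m$ has length $m$, so at time $m$ the value of $\mathit{next}$ is $m\bmod|\mathcal L_{in}|$. $[a,b)$ denotes the cyclic interval of lanes $a,a+1,\dots,b-1$ modulo $|\mathcal L_{in}|$ (empty if $a=b$). Since $\sigma$ is empty, $\mathbf P$ is: agent $i$ does "if $K_i(\mathit{front}_i\wedge V_i')$ then $\mathtt{go}$ else $\mathtt{noop}$", where $V_i'$ says that the move $(\mathit{lane}_i,\mathit{intent}_i)$ is compatible with all moves $(\mathit{lane}_j,\mathit{intent}_j)$ of agents $j\neq i$ with $\mathit{lane}_j\in[\mathit{next},\mathit{lane}_i)$ such that $\mathit{going}_j$ holds. $P$ implements "if $K_i\phi_i$ then $\mathtt{go}$ else $\mathtt{noop}$" w.r.t. $\gamma$ if for all points $(r,m)$ of $\mathcal I_{\gamma,P}$ and all $i$: $P_i(r_i(m))=\mathtt{go}$ iff $K_i\phi_i$ holds at $(r,m)$ in $\mathcal I_{\gamma,P}$. **Protocol $P^\emptyset$.** From agent $i$'s local state (with $\mathit{lane}_i\in\mathcal L_{in}$) compute a set $\mathit{Pos}_i$ of moves: start with $\mathit{Pos}_i=\emptyset$; for $l$ ranging in cyclic order over $[\mathit{next},\mathit{lane}_i)$, let $L$ be the set of moves $(l,l')$, $l'\in\mathcal L_{out}$, that are compatible with the current $\mathit{Pos}_i$, and replace $\mathit{Pos}_i$ by $\mathit{Pos}_i\cup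 L$; output $\mathit{Pos}_i$. $P^\emptyset_i$: if $\mathit{front}_i$ and $(\mathit{lane}_i,\mathit{intent}_i)$ is compatible with $\mathit{Pos}_i$, then $\mathtt{go}$, else $\mathtt{noop}$.
   Formalization: The set of agents Ag is assumed not to be a singleton; with exactly one agent the claim fails (e.g. two incoming lanes and an empty compatibility relation: P^∅ may do noop although the agent knows that no other agent is going). *)

theory Defs
  imports Main
begin

type_synonym agent = nat
type_synonym lane = nat
type_synonym move = "lane \<times> lane"

text \<open>Incoming lanes are \<open>0, \<dots>, num_in - 1\<close>, outgoing lanes \<open>num_in, \<dots>, num_lanes - 1\<close>.\<close>

record intersection =
  agents :: "agent set"
  num_lanes :: nat
  num_in :: nat
  compat_rel :: "(move \<times> move) set"

definition lanes_in :: "intersection \<Rightarrow> lane set" where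
  "lanes_in S = {0..<num_in S}"

definition lanes_out :: "intersection \<Rightarrow> lane set" where
  "lanes_out S = {num_in S..<num_lanes S}"

definition moves :: "intersection \<Rightarrow> move set" where
  "moves S = lanes_in S \<times> lanes_out S"

definition valid_intersection :: "intersection \<Rightarrow> bool" where
  "valid_intersection S \<longleftrightarrow>
     1 < num_in S \<and> num_in S < num_lanes S \<and>
     compat_rel S \<subseteq> moves S \<times> moves S \<and> sym (compat_rel S)"

definition compatible :: "intersection \<Rightarrow> move \<Rightarrow> move set \<Rightarrow> bool" where
  "compatible S mv M \<longleftrightarrow> (\<forall>mv'\<in>M. (mv, mv') \<in> compat_rel S)"

text \<open>
  The functions on agents are represented by total functions on \<^typ>\<open>nat\<close>; their values
  outside \<open>agents S\<close> are unconstrained and never used.  For \<open>transmits\<close> and \<open>receives\<close> the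
  Boolean \<^term>\<open>False\<close> at \<open>m\<close>, \<open>i\<close> is the value 0: the transmitter (receiver) of \<open>i\<close> fails in
  round \<open>m + 1\<close>.
\<close>

record adversary =
  arrival :: "agent \<Rightarrow> nat \<times> lane \<times> lane"
  transmission :: "((lane \<times> nat) \<times> (lane \<times> nat)) set"
  transmits :: "nat \<Rightarrow> agent \<Rightarrow> bool"
  receives :: "nat \<Rightarrow> agent \<Rightarrow> bool"

definition arr_time :: "adversary \<Rightarrow> agent \<Rightarrow> nat" where
  "arr_time \<alpha> i = fst (arrival \<alpha> i)"

definition arr_lane :: "adversary \<Rightarrow> agent \<Rightarrow> lane" where
  "arr_lane \<alpha> i = fst (snd (arrival \<alpha> i))"

definition dep_lane :: "adversary \<Rightarrow> agent \<Rightarrow> lane" where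
  "dep_lane \<alpha> i = snd (snd (arrival \<alpha> i))"

definition transmission_environment ::
    "intersection \<Rightarrow> ((lane \<times> nat) \<times> (lane \<times> nat)) set \<Rightarrow> bool" where
  "transmission_environment S T \<longleftrightarrow>
     T \<subseteq> (lanes_in S \<times> UNIV) \<times> (lanes_in S \<times> UNIV) \<and>
     (\<forall>l\<in>lanes_in S. \<forall>l'\<in>lanes_in S. ((l, 0), (l', 0)) \<in> T)"

definition adversaries :: "intersection \<Rightarrow> adversary set" where
  "adversaries S = {\<alpha>.
     (\<forall>i\<in>agents S. arr_lane \<alpha> i \<in> lanes_in S \<and> dep_lane \<alpha> i \<in> lanes_out S) \<and>
     (\<forall>i\<in>agents S. \<forall>j\<in>agents S. i \<noteq> j \<longrightarrow> arr_time \<alpha> i = arr_time \<alpha> j \<longrightarrow>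
        arr_lane \<alpha> i \<noteq> arr_lane \<alpha> j) \<and>
     transmission_environment S (transmission \<alpha>)}"

definition NF :: "intersection \<Rightarrow> adversary set" where
  "NF S = {\<alpha>\<in>adversaries S. \<forall>m. \<forall>i\<in>agents S. transmits \<alpha> m i \<and> receives \<alpha> m i}"

definition CR :: "intersection \<Rightarrow> adversary set" where
  "CR S = {\<alpha>\<in>adversaries S.
     (\<forall>m. \<forall>i\<in>agents S. receives \<alpha> m i) \<and>
     (\<forall>m. \<forall>i\<in>agents S. \<not> transmits \<alpha> m i \<longrightarrow> (\<forall>m'>m. \<not> transmits \<alpha> m' i))}"

definition SO :: "intersection \<Rightarrow> adversary set" where
  "SO S = {\<alpha>\<in>adversaries S. \<forall>m. \<forall>i\<in>agents S. receives \<alpha> m i}"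

record env_state =
  adv :: adversary
  clock :: nat
  queue :: "lane \<Rightarrow> agent list"  \<comment> \<open>the head of the list is the front of the queue\<close>
  departed :: "agent set"

datatype position = InLane lane | Departed | NotArrived

record local_state =
  front :: bool
  lane :: position
  intent :: lane
  now :: nat

definition at_front :: "intersection \<Rightarrow> env_state \<Rightarrow> agent \<Rightarrow> bool" where
  "at_front S s i \<longleftrightarrow> (\<exists>l\<in>lanes_in S. queue s l \<noteq> [] \<and> hd (queue s l) = i)"

text \<open>
  An agent occurs in at most one queue of any state reached in a run, so the description below
  is uniquely satisfied there.
\<close>

definition position_of :: "intersection \<Rightarrow> env_state \<Rightarrow> agent \<Rightarrow> position" where
  "position_of S s i =
     (if \<exists>l\<in>lanes_in S. i \<in> set (queue s l)
      then InLane (THE l. l \<in> lanes_in S \<and> i \<in> set (queue s l))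
      else if i \<in> departed s then Departed else NotArrived)"

definition sensor :: "intersection \<Rightarrow> env_state \<Rightarrow> agent \<Rightarrow> local_state" where
  "sensor S s i =
     \<lparr>front = at_front S s i, lane = position_of S s i,
      intent = dep_lane (adv s) i, now = clock s\<rparr>"

datatype action = Go | Noop

type_synonym protocol = "agent \<Rightarrow> local_state \<Rightarrow> action"

definition initial_state :: "adversary \<Rightarrow> env_state" where
  "initial_state \<alpha> = \<lparr>adv = \<alpha>, clock = 0, queue = (\<lambda>_. []), departed = {}\<rparr>"

definition goes :: "intersection \<Rightarrow> protocol \<Rightarrow> env_state \<Rightarrow> agent \<Rightarrow> bool" where
  "goes S P s i \<longleftrightarrow> at_front S s i \<and> P i (sensor S s i) = Go"

definition dequeue :: "intersection \<Rightarrow> protocol \<Rightarrow> env_state \<Rightarrow> agent list \<Rightarrow> agent list" where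
  "dequeue S P s q = (if q \<noteq> [] \<and> goes S P s (hd q) then tl q else q)"

text \<open>
  For every adversary at most one agent arrives in a given lane at a given time; hence the order
  chosen by \<^const>\<open>sorted_list_of_set\<close> is immaterial.
\<close>

definition arrivals :: "intersection \<Rightarrow> adversary \<Rightarrow> nat \<Rightarrow> lane \<Rightarrow> agent list" where
  "arrivals S \<alpha> m l =
     sorted_list_of_set {i\<in>agents S. arr_time \<alpha> i = m \<and> arr_lane \<alpha> i = l}"

definition step :: "intersection \<Rightarrow> protocol \<Rightarrow> env_state \<Rightarrow> env_state" where
  "step S P s =
     \<lparr>adv = adv s,
      clock = Suc (clock s),
      queue = (\<lambda>l. dequeue S P s (queue s l) @ arrivals S (adv s) (Suc (clock s)) l),
      departed = departed s \<union> {i\<in>agents S. goes S P s i}\<rparr>"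

text \<open>
  Local states are determined by the environment state through \<^const>\<open>sensor\<close>, so a run is
  represented by its sequence of environment states.
\<close>

type_synonym run = "nat \<Rightarrow> env_state"

definition system :: "intersection \<Rightarrow> adversary set \<Rightarrow> protocol \<Rightarrow> run set" where
  "system S \<F> P =
     {r. (\<exists>\<alpha>\<in>\<F>. r 0 = initial_state \<alpha>) \<and> (\<forall>m. r (Suc m) = step S P (r m))}"

definition local :: "intersection \<Rightarrow> run \<Rightarrow> agent \<Rightarrow> nat \<Rightarrow> local_state" where
  "local S r i m = sensor S (r m) i"

type_synonym formula = "run \<Rightarrow> nat \<Rightarrow> bool"

definition knows :: "intersection \<Rightarrow> run set \<Rightarrow> agent \<Rightarrow> formula \<Rightarrow> formula" where
  "knows S R i \<phi> r m \<longleftrightarrow> (\<forall>r'\<in>R. \<forall>m'. local S r' i m' = local S r i m \<longrightarrow> \<phi> r' m')"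

text \<open>\<open>P\<close> implements the program ``if \<open>K\<^sub>i \<phi>\<^sub>i\<close> then go else noop''.\<close>

definition implements ::
    "intersection \<Rightarrow> adversary set \<Rightarrow> protocol \<Rightarrow> (agent \<Rightarrow> formula) \<Rightarrow> bool" where
  "implements S \<F> P \<phi> \<longleftrightarrow>
     (\<forall>r\<in>system S \<F> P. \<forall>m. \<forall>i\<in>agents S.
        P i (local S r i m) = Go \<longleftrightarrow> knows S (system S \<F> P) i (\<phi> i) r m)"

definition going :: "intersection \<Rightarrow> agent \<Rightarrow> formula" where
  "going S i r m \<longleftrightarrow> front (local S r i m) \<and> \<not> front (local S r i (Suc m))"

text \<open>The value of \<open>next\<close> on an adversary history of length \<open>m\<close>, that is, at time \<open>m\<close>.\<close>

definition next_lane :: "intersection \<Rightarrow> nat \<Rightarrow> lane" where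
  "next_lane S m = m mod num_in S"

text \<open>
  The cyclic interval \<open>[a, b)\<close> of incoming lanes in cyclic order, for \<open>a, b < num_in S\<close>; its
  length is \<open>b - a\<close> modulo \<open>num_in S\<close>, written without truncated subtraction.
\<close>

definition cyclic_interval :: "intersection \<Rightarrow> lane \<Rightarrow> lane \<Rightarrow> lane list" where
  "cyclic_interval S a b =
     map (\<lambda>d. (a + d) mod num_in S) [0..<(b + num_in S - a) mod num_in S]"

text \<open>
  The condition is vacuous if \<open>i\<close> is in no lane; it is only used in conjunction with
  \<open>front\<^sub>i\<close>.
\<close>

definition V' :: "intersection \<Rightarrow> agent \<Rightarrow> formula" where
  "V' S i r m \<longleftrightarrow>
     (\<forall>l. lane (local S r i m) = InLane l \<longrightarrow>
        compatible S (l, intent (local S r i m))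
          {(l', intent (local S r j m)) | j l'.
             j \<in> agents S \<and> j \<noteq> i \<and> lane (local S r j m) = InLane l' \<and>
             l' \<in> set (cyclic_interval S (next_lane S m) l) \<and> going S j r m})"

text \<open>The formula tested by agent \<open>i\<close> in the program \<open>\<^bold>P\<close> with \<open>\<sigma>\<close> empty.\<close>

definition program_P :: "intersection \<Rightarrow> agent \<Rightarrow> formula" where
  "program_P S i r m \<longleftrightarrow> front (local S r i m) \<and> V' S i r m"

definition add_possible :: "intersection \<Rightarrow> move set \<Rightarrow> lane \<Rightarrow> move set" where
  "add_possible S M l = M \<union> {(l, l') | l'. l' \<in> lanes_out S \<and> compatible S (l, l') M}"

definition Pos :: "intersection \<Rightarrow> nat \<Rightarrow> lane \<Rightarrow> move set" where
  "Pos S m l = foldl (add_possible S) {} (cyclic_interval S (next_lane S m) l)"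

definition P_empty :: "intersection \<Rightarrow> protocol" where
  "P_empty S i x =
     (case lane x of
        InLane l \<Rightarrow>
          if front x \<and> compatible S (l, intent x) (Pos S (now x) l) then Go else Noop
      | _ \<Rightarrow> Noop)"

end

(* The set Pos contains exactly the moves that some agent in an earlier lane of the cyclic order
   could be making.  If an agent's move is incompatible with a move (l', d') in Pos, then it
   cannot distinguish its situation from a run in which it has just arrived together with a
   single other agent, which is in lane l' with intent d' and goes. *)
theory Submission
  imports Defs
begin

section \<open>Possible moves\<close>

text \<open>The offset of a lane from \<open>a\<close> is recovered from the lane, so a proper
  prefix of a cyclic interval starting at \<open>a\<close> is again the cyclic interval up to the
  lane where it stops.\<close>

lemma cyclic_interval_offset:
  fixes a d n :: nat
  assumes "a < n" "d < n"
  shows "((a + d) mod n + n - a) mod n = d"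
proof (cases "a + d < n")
  case False
  then have "(a + d) mod n = a + d - n"
    using assms by (simp add: mod_if)
  then show ?thesis using assms False by simp
qed (use assms in simp)

lemma set_cyclic_interval:
  assumes "a < num_in S"
  shows "set (cyclic_interval S a l) =
    (\<lambda>d. (a + d) mod num_in S) ` {..<(l + num_in S - a) mod num_in S}"
  by (auto simp: cyclic_interval_def)

text \<open>The offset of \<open>l'\<close> from \<open>a\<close> is strictly below that of
  \<open>l\<close>, which separates the two lanes.\<close>

lemma mem_cyclic_intervalD:
  assumes "a < num_in S" "l' \<in> set (cyclic_interval S a l)"
  shows "l' \<in> lanes_in S" "l' \<noteq> l"
proof -
  obtain d where d: "d < (l + num_in S - a) mod num_in S" "l' = (a + d) mod num_in S"
    using assms by (auto simp: set_cyclic_interval)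
  have n: "0 < num_in S" using assms by simp
  then have "d < num_in S"
    using d(1) by (meson less_trans mod_less_divisor)
  then have "(l' + num_in S - a) mod num_in S = d"
    using cyclic_interval_offset assms(1) d(2) by blast
  then show "l' \<noteq> l" using d(1) by auto
  show "l' \<in> lanes_in S" using n d(2) by (simp add: lanes_in_def)
qed

lemma mem_foldl_add_possible:
  "mv \<in> foldl (add_possible S) {} (map f [0..<D]) \<longleftrightarrow>
    (\<exists>d<D. fst mv = f d \<and> snd mv \<in> lanes_out S \<and>
      compatible S mv (foldl (add_possible S) {} (map f [0..<d])))"
proof (induction D)
  case (Suc D)
  have "mv \<in> add_possible S M l \<longleftrightarrow>
      mv \<in> M \<or> (fst mv = l \<and> snd mv \<in> lanes_out S \<and> compatible S mv M)" for M l
    by (cases mv) (auto simp: add_possible_def)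
  then show ?case using Suc.IH by (auto simp: less_Suc_eq)
qed simp

text \<open>When the loop for \<open>l\<close> reaches \<open>l'\<close>, it has processed exactly
  the interval from \<open>next_lane S m\<close> to \<open>l'\<close>, so the set built so far is
  \<open>Pos S m l'\<close>. This turns the loop into a recursion whose last conjunct is the test
  that a front agent in \<open>l'\<close> with intent \<open>d'\<close> makes itself.\<close>

lemma mem_Pos_iff:
  assumes "0 < num_in S"
  shows "(l', d') \<in> Pos S m l \<longleftrightarrow>
    l' \<in> set (cyclic_interval S (next_lane S m) l) \<and> d' \<in> lanes_out S \<and>
    compatible S (l', d') (Pos S m l')"
proof -
  define a where "a = next_lane S m"
  have a: "a < num_in S" using assms by (simp add: a_def next_lane_def)
  define f where "f = (\<lambda>d. (a + d) mod num_in S)"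
  define Q where "Q d = foldl (add_possible S) {} (map f [0..<d])" for d
  have Pos_eq: "Pos S m k = Q ((k + num_in S - a) mod num_in S)" for k
    by (simp add: Pos_def cyclic_interval_def Q_def f_def a_def)
  have Q_eq: "Q d = Pos S m (f d)" if "d < (l + num_in S - a) mod num_in S" for d
  proof -
    have "d < num_in S"
      using that assms by (meson less_trans mod_less_divisor)
    then show ?thesis
      using cyclic_interval_offset[OF a] by (simp add: Pos_eq f_def)
  qed
  have "(l', d') \<in> Pos S m l \<longleftrightarrow> (\<exists>d<(l + num_in S - a) mod num_in S.
      l' = f d \<and> d' \<in> lanes_out S \<and> compatible S (l', d') (Q d))"
    unfolding Pos_eq Q_def mem_foldl_add_possible by simp
  also have "\<dots> \<longleftrightarrow> l' \<in> set (cyclic_interval S a l) \<and> d' \<in> lanes_out S \<and>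
      compatible S (l', d') (Pos S m l')"
    using Q_eq by (auto simp: set_cyclic_interval[OF a] f_def)
  finally show ?thesis by (simp add: a_def)
qed


section \<open>Runs\<close>

text \<open>The chain allows one argument for all three models, based only on
  \<open>NF S \<subseteq> \<F>\<close> and \<open>\<F> \<subseteq> adversaries S\<close>.\<close>

lemma NF_subset_CR: "NF S \<subseteq> CR S" and CR_subset_SO: "CR S \<subseteq> SO S"
  and SO_subset_adversaries: "SO S \<subseteq> adversaries S"
  by (auto simp: NF_def CR_def SO_def)

lemma ex_run:
  assumes "\<alpha> \<in> \<F>"
  obtains r where "r \<in> system S \<F> P" "r 0 = initial_state \<alpha>"
proof
  let ?r = "\<lambda>m. (step S P ^^ m) (initial_state \<alpha>)"
  show "?r \<in> system S \<F> P" using assms by (auto simp: system_def)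
qed simp

lemma run_step: "r \<in> system S \<F> P \<Longrightarrow> r (Suc m) = step S P (r m)"
  by (simp add: system_def)

lemma run_clock:
  assumes "r \<in> system S \<F> P"
  shows "clock (r m) = m"
proof (induction m)
  case 0
  then show ?case using assms by (auto simp: system_def initial_state_def)
qed (simp add: run_step[OF assms] step_def)

lemma run_adv:
  assumes "r \<in> system S \<F> P"
  shows "adv (r m) = adv (r 0)"
  by (induction m) (simp_all add: run_step[OF assms] step_def)

lemma run_adv_mem:
  assumes "r \<in> system S \<F> P"
  shows "adv (r m) \<in> \<F>"
  using assms run_adv[OF assms, of m] by (auto simp: system_def initial_state_def)

lemma set_arrivals: "set (arrivals S \<alpha> m l) \<subseteq> {i\<in>agents S. arr_time \<alpha> i = m \<and> arr_lane \<alpha> i = l}"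
proof -
  \<comment> \<open>On an infinite set \<open>sorted_list_of_set\<close> defaults to the empty list,
    so the inclusion holds in both cases.\<close>
  have "set (sorted_list_of_set A) \<subseteq> A" for A :: "nat set"
    by (cases "finite A") auto
  then show ?thesis by (simp add: arrivals_def)
qed

lemma set_dequeue: "set (dequeue S P s q) \<subseteq> set q"
  by (cases q) (auto simp: dequeue_def)

(* Agents arriving at time 0 never enter a queue, since round m + 1 only admits time m + 1. *)
lemma mem_queueD:
  assumes r: "r \<in> system S \<F> P" and "i \<in> set (queue (r m) l)"
  shows "arr_lane (adv (r 0)) i = l" "0 < arr_time (adv (r 0)) i" "arr_time (adv (r 0)) i \<le> m"
proof -
  have "arr_lane (adv (r 0)) i = l \<and> 0 < arr_time (adv (r 0)) i \<and> arr_time (adv (r 0)) i \<le> m"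
    using assms(2)
  proof (induction m)
    case 0
    then show ?case using r by (auto simp: system_def initial_state_def)
  next
    case (Suc m)
    then have "i \<in> set (queue (r m) l) \<or> i \<in> set (arrivals S (adv (r 0)) (Suc m) l)"
      using set_dequeue[of S P "r m" "queue (r m) l"]
      by (auto simp: run_step[OF r] step_def run_adv[OF r, of m] run_clock[OF r])
    then show ?case
      using Suc.IH set_arrivals[of S "adv (r 0)" "Suc m" l] by auto
  qed
  then show "arr_lane (adv (r 0)) i = l" "0 < arr_time (adv (r 0)) i"
    "arr_time (adv (r 0)) i \<le> m" by auto
qed

text \<open>The only queue that can contain \<open>i\<close> is that of its arrival lane, which
  makes the description in \<open>position_of\<close> unique.\<close>

lemma position_of_queued:
  assumes r: "r \<in> system S \<F> P" and i: "i \<in> set (queue (r m) l)" and l: "l \<in> lanes_in S"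
  shows "position_of S (r m) i = InLane l"
proof -
  have "(THE l. l \<in> lanes_in S \<and> i \<in> set (queue (r m) l)) = l"
    using i l by (auto intro!: the_equality dest: mem_queueD(1)[OF r])
  then show ?thesis using i l by (auto simp: position_of_def)
qed

lemma local_intent: "intent (local S r i m) = dep_lane (adv (r m)) i"
  by (simp add: local_def sensor_def)

lemma local_now: "r \<in> system S \<F> P \<Longrightarrow> now (local S r i m) = m"
  by (simp add: local_def sensor_def run_clock)

text \<open>New arrivals are appended at the back, so a front agent that does not perform
  \<open>Go\<close> is still at the front one round later.\<close>

lemma going_imp_goes:
  assumes r: "r \<in> system S \<F> P" and "going S i r m"
  shows "P i (local S r i m) = Go"
proof (rule ccontr)
  assume "P i (local S r i m) \<noteq> Go"
  then have "\<not> goes S P (r m) i" by (simp add: goes_def local_def)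
  moreover obtain l where "l \<in> lanes_in S" "queue (r m) l \<noteq> []" "hd (queue (r m) l) = i"
    using assms(2) by (auto simp: going_def local_def sensor_def at_front_def)
  ultimately have "queue (r (Suc m)) l \<noteq> [] \<and> hd (queue (r (Suc m)) l) = i"
    by (simp add: run_step[OF r] step_def dequeue_def)
  then have "at_front S (r (Suc m)) i"
    using \<open>l \<in> lanes_in S\<close> by (auto simp: at_front_def)
  then show False using assms(2) by (simp add: going_def local_def sensor_def)
qed

text \<open>All queues are empty until the first arrivals at time \<open>m\<close>, so an agent
  arriving then alone in its lane is immediately at the front. This computes local states in the run
  built below.\<close>

lemma first_arrival:
  assumes r: "r \<in> system S \<F> P"
    and none: "\<And>k. k \<in> agents S \<Longrightarrow> m \<le> arr_time (adv (r 0)) k"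
    and i: "{k\<in>agents S. arr_time (adv (r 0)) k = m \<and> arr_lane (adv (r 0)) k = l} = {i}"
    and "0 < m" "l \<in> lanes_in S"
  shows "queue (r m) l = [i]"
    and "local S r i m =
      \<lparr>front = True, lane = InLane l, intent = dep_lane (adv (r 0)) i, now = m\<rparr>"
proof -
  obtain m0 where m: "m = Suc m0" using \<open>0 < m\<close> by (cases m) auto
  \<comment> \<open>The assumption \<open>none\<close> bounds arrival times only inside
    \<open>agents S\<close>.\<close>
  have subset: "set (queue (r k) l') \<subseteq> agents S" for k l'
  proof (induction k arbitrary: l')
    case 0
    then show ?case using r by (auto simp: system_def initial_state_def)
  next
    case (Suc k)
    then show ?case
      using set_dequeue[of S P "r k" "queue (r k) l'"] set_arrivals
      by (fastforce simp: run_step[OF r] step_def)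
  qed
  have empty: "queue (r m0) l' = []" for l'
  proof (rule ccontr)
    assume "queue (r m0) l' \<noteq> []"
    then have h: "hd (queue (r m0) l') \<in> set (queue (r m0) l')" by simp
    then show False
      using mem_queueD(3)[OF r h] none[of "hd (queue (r m0) l')"] subset m by fastforce
  qed
  show q: "queue (r m) l = [i]"
    using i by (simp add: m run_step[OF r] step_def empty dequeue_def arrivals_def
        run_adv[OF r, of m0] run_clock[OF r])
  then show "local S r i m =
      \<lparr>front = True, lane = InLane l, intent = dep_lane (adv (r 0)) i, now = m\<rparr>"
    using position_of_queued[OF r, of i m l] \<open>l \<in> lanes_in S\<close>
    by (auto simp: local_def sensor_def at_front_def run_clock[OF r] run_adv[OF r, of m]
        intro!: bexI[of _ l])
qed

text \<open>Besides being dequeued, \<open>j\<close> must not be at a front at the next time. It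
  cannot reappear: its arrival time has passed, and only the queue of its arrival lane could hold
  it, whose sole entry was just removed.\<close>

lemma singleton_queue_going:
  assumes r: "r \<in> system S \<F> P" and q: "queue (r m) l = [j]" and l: "l \<in> lanes_in S"
    and Go: "P j (local S r j m) = Go"
  shows "going S j r m"
proof -
  have front: "at_front S (r m) j" using q l by (auto simp: at_front_def intro!: bexI[of _ l])
  have goes: "goes S P (r m) j" using front Go by (simp add: goes_def local_def)
  have "j \<notin> set (queue (r (Suc m)) k)" for k
  proof
    assume j: "j \<in> set (queue (r (Suc m)) k)"
    have "arr_lane (adv (r 0)) j = k" "arr_lane (adv (r 0)) j = l" "arr_time (adv (r 0)) j \<le> m"
      using mem_queueD[OF r j] mem_queueD[OF r, of j m l] q by auto
    moreover have "j \<notin> set (arrivals S (adv (r 0)) (Suc m) k)"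
      using set_arrivals \<open>arr_time (adv (r 0)) j \<le> m\<close> by fastforce
    ultimately show False
      using j q goes by (simp add: run_step[OF r] step_def dequeue_def run_adv[OF r, of m]
          run_clock[OF r])
  qed
  then have "\<not> at_front S (r (Suc m)) j"
    by (metis at_front_def hd_in_set)
  then show ?thesis using front by (simp add: going_def local_def sensor_def)
qed


section \<open>The protocol\<close>

lemma P_empty_eq_Go_iff:
  "P_empty S i x = Go \<longleftrightarrow>
    (\<exists>l. lane x = InLane l \<and> front x \<and> compatible S (l, intent x) (Pos S (now x) l))"
  by (auto simp: P_empty_def split: position.splits)

text \<open>A going agent in an earlier lane has passed its own test against \<open>Pos\<close>, so
  by \<open>mem_Pos_iff\<close> its move lies in the \<open>Pos\<close> of \<open>i\<close>.
  Compatibility with all possible moves thus covers the actual ones.\<close>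

lemma Go_imp_program_P:
  assumes "0 < num_in S" and \<F>: "\<F> \<subseteq> adversaries S"
    and r: "r \<in> system S \<F> (P_empty S)" and Go: "P_empty S i (local S r i m) = Go"
  shows "program_P S i r m"
proof -
  obtain l where l: "lane (local S r i m) = InLane l" "front (local S r i m)"
    and comp: "compatible S (l, intent (local S r i m)) (Pos S m l)"
    using Go by (auto simp: P_empty_eq_Go_iff local_now[OF r])
  have "(l', intent (local S r j m)) \<in> Pos S m l"
    if j: "j \<in> agents S" "lane (local S r j m) = InLane l'" "going S j r m"
      and l': "l' \<in> set (cyclic_interval S (next_lane S m) l)" for j l'
  proof -
    have "compatible S (l', intent (local S r j m)) (Pos S m l')"
      using going_imp_goes[OF r j(3)] j(2) by (auto simp: P_empty_eq_Go_iff local_now[OF r])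
    moreover have "intent (local S r j m) \<in> lanes_out S"
      using run_adv_mem[OF r, of m] \<F> j(1) by (auto simp: local_intent adversaries_def)
    ultimately show ?thesis
      using l' by (simp add: mem_Pos_iff[OF assms(1)])
  qed
  then have "V' S i r m"
    using l comp unfolding V'_def compatible_def by auto
  then show ?thesis using l by (simp add: program_P_def)
qed

text \<open>The run comes from a failure-free adversary, so it exists in every model containing
  \<open>NF S\<close>. That \<open>j\<close> goes in it is the last conjunct of
  \<open>mem_Pos_iff\<close> for \<open>(l', d)\<close>.\<close>

lemma ex_conflicting_run:
  assumes "0 < num_in S" and \<F>: "NF S \<subseteq> \<F>"
    and ij: "i \<in> agents S" "j \<in> agents S" "j \<noteq> i"
    and "0 < m" "l \<in> lanes_in S" "e \<in> lanes_out S"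
    and pos: "(l', d) \<in> Pos S m l" and incomp: "((l, e), (l', d)) \<notin> compat_rel S"
  obtains r where "r \<in> system S \<F> (P_empty S)"
    "local S r i m = \<lparr>front = True, lane = InLane l, intent = e, now = m\<rparr>"
    "\<not> V' S i r m"
proof -
  have next_less: "next_lane S m < num_in S" using assms(1) by (simp add: next_lane_def)
  have l': "l' \<in> set (cyclic_interval S (next_lane S m) l)" "d \<in> lanes_out S"
    "compatible S (l', d) (Pos S m l')"
    using pos by (auto simp: mem_Pos_iff[OF assms(1)])
  have l'_in: "l' \<in> lanes_in S" and "l' \<noteq> l"
    using mem_cyclic_intervalD[OF next_less l'(1)] by auto
  \<comment> \<open>The remaining agents arrive after \<open>m\<close> at pairwise distinct times,
    so they neither influence time \<open>m\<close> nor violate the condition on simultaneous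
    arrivals, even if there are infinitely many.\<close>
  define \<alpha> where "\<alpha> = \<lparr>arrival = (\<lambda>k. if k = i then (m, l, e) else if k = j then (m, l', d)
      else (Suc (m + k), l, e)), transmission = (lanes_in S \<times> UNIV) \<times> (lanes_in S \<times> UNIV),
      transmits = (\<lambda>_ _. True), receives = (\<lambda>_ _. True)\<rparr>"
  note arr = arr_time_def arr_lane_def dep_lane_def \<alpha>_def
  have "\<alpha> \<in> adversaries S"
    using assms(7,8) l'(2) l'_in \<open>l' \<noteq> l\<close>
    by (auto simp: adversaries_def arr transmission_environment_def)
  then have "\<alpha> \<in> \<F>" using \<F> by (auto simp: NF_def \<alpha>_def)
  then obtain r where r: "r \<in> system S \<F> (P_empty S)" and "r 0 = initial_state \<alpha>"
    by (rule ex_run)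
  then have adv: "adv (r 0) = \<alpha>" by (simp add: initial_state_def)
  have late: "m \<le> arr_time (adv (r 0)) k" for k
    unfolding adv by (simp add: arr)
  have i: "{k\<in>agents S. arr_time (adv (r 0)) k = m \<and> arr_lane (adv (r 0)) k = l} = {i}"
    unfolding adv using ij \<open>l' \<noteq> l\<close> by (auto simp: arr split: if_splits)
  have j: "{k\<in>agents S. arr_time (adv (r 0)) k = m \<and> arr_lane (adv (r 0)) k = l'} = {j}"
    unfolding adv using ij \<open>l' \<noteq> l\<close> by (auto simp: arr split: if_splits)
  have local_i: "local S r i m = \<lparr>front = True, lane = InLane l, intent = e, now = m\<rparr>"
    using first_arrival(2)[OF r late i \<open>0 < m\<close> \<open>l \<in> lanes_in S\<close>]
    unfolding adv by (simp add: arr)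
  have local_j: "local S r j m = \<lparr>front = True, lane = InLane l', intent = d, now = m\<rparr>"
    using first_arrival(2)[OF r late j \<open>0 < m\<close> l'_in] ij
    unfolding adv by (simp add: arr)
  have "P_empty S j (local S r j m) = Go"
    using l'(3) by (simp add: P_empty_eq_Go_iff local_j)
  then have "going S j r m"
    using singleton_queue_going[OF r first_arrival(1)[OF r late j \<open>0 < m\<close> l'_in] l'_in] by blast
  then have "\<exists>j' l''. (l', d) = (l'', intent (local S r j' m)) \<and> j' \<in> agents S \<and> j' \<noteq> i \<and>
      lane (local S r j' m) = InLane l'' \<and>
      l'' \<in> set (cyclic_interval S (next_lane S m) l) \<and> going S j' r m"
    using local_j ij l'(1) by (intro exI[of _ j] exI[of _ l']) simp
  then have "\<not> V' S i r m"
    using incomp local_i unfolding V'_def compatible_def by fastforce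
  then show thesis using that r local_i by blast
qed

lemma knows_program_P_imp_Go:
  assumes "0 < num_in S" and \<F>: "NF S \<subseteq> \<F>" "\<F> \<subseteq> adversaries S"
    and i: "i \<in> agents S" and "\<not> is_singleton (agents S)"
    and r: "r \<in> system S \<F> (P_empty S)"
    and K: "knows S (system S \<F> (P_empty S)) i (program_P S i) r m"
  shows "P_empty S i (local S r i m) = Go"
proof (rule ccontr)
  assume not_Go: "P_empty S i (local S r i m) \<noteq> Go"
  obtain j where j: "j \<in> agents S" "j \<noteq> i"
    using i \<open>\<not> is_singleton (agents S)\<close> is_singletonI'[of "agents S"] by blast
  \<comment> \<open>Knowledge implies truth, since \<open>(r, m)\<close> is one of the points
    considered possible.\<close>
  have front: "front (local S r i m)"
    using K r by (auto simp: knows_def program_P_def)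
  then obtain l where l: "l \<in> lanes_in S" and queued: "i \<in> set (queue (r m) l)"
    by (auto simp: local_def sensor_def at_front_def)
  define e where "e = intent (local S r i m)"
  have e: "e \<in> lanes_out S"
    using run_adv_mem[OF r, of m] \<F> i by (auto simp: e_def local_intent adversaries_def)
  have lane: "lane (local S r i m) = InLane l"
    using position_of_queued[OF r queued l] by (simp add: local_def sensor_def)
  \<comment> \<open>A queued agent has a positive arrival time not exceeding \<open>m\<close>; the
    conflicting run needs a round that ends at time \<open>m\<close>.\<close>
  have "0 < m" using mem_queueD[OF r queued] by simp
  have "\<not> compatible S (l, e) (Pos S m l)"
    using not_Go front lane by (auto simp: P_empty_eq_Go_iff local_now[OF r] e_def)
  then obtain l' d where "(l', d) \<in> Pos S m l" "((l, e), (l', d)) \<notin> compat_rel S"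
    by (auto simp: compatible_def)
  then obtain r' where r': "r' \<in> system S \<F> (P_empty S)" "\<not> V' S i r' m"
    and local': "local S r' i m = \<lparr>front = True, lane = InLane l, intent = e, now = m\<rparr>"
    using ex_conflicting_run[OF assms(1) \<F>(1) i j \<open>0 < m\<close> l e] by metis
  have "local S r' i m = local S r i m"
    using local' front lane local_now[OF r, of i m] by (simp add: e_def)
  then show False
    using K r' by (auto simp: knows_def program_P_def)
qed

theorem proposition21:
  fixes S :: intersection and \<F> :: "adversary set"
  assumes "valid_intersection S"
    and "\<not> is_singleton (agents S)"
    and "\<F> \<in> {NF S, CR S, SO S}"
  shows "implements S \<F> (P_empty S) (program_P S)"
proof -
  have n: "0 < num_in S" using assms(1) by (simp add: valid_intersection_def)
  have \<F>: "NF S \<subseteq> \<F>" "\<F> \<subseteq> adversaries S"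
    using assms(3) NF_subset_CR CR_subset_SO SO_subset_adversaries by blast+
  show ?thesis
    unfolding implements_def
  proof (intro ballI allI iffI)
    fix r m i
    assume r: "r \<in> system S \<F> (P_empty S)" and i: "i \<in> agents S"
    show "P_empty S i (local S r i m) = Go"
      if "knows S (system S \<F> (P_empty S)) i (program_P S i) r m"
      using knows_program_P_imp_Go[OF n \<F> i assms(2) r that] .
    show "knows S (system S \<F> (P_empty S)) i (program_P S i) r m"
      if Go: "P_empty S i (local S r i m) = Go"
      \<comment> \<open>The action depends only on the local state, so \<open>i\<close> performs
        \<open>Go\<close> at every indistinguishable point, and \<open>Go_imp_program_P\<close>
        applies there.\<close>
      unfolding knows_def using Go_imp_program_P[OF n \<F>(2)] Go by metis
  qed
qed

end
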